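(* If $\Omega_+$ and $\Omega_-$ are open, $0$-symmetric subsets of a locally compact Abelian group $G$, then $$\mathcal{C}_1(\Omega_+, \Omega_-) = \mathcal{C}_c(\Omega_+, \Omega_-).$$
   Context: $G$ is written additively with a fixed Haar measure $m_G$; integrals over $G$ are with respect to $m_G$. A set $A\subset G$ is $0$-symmetric if $A=-A$. $A_1\Subset A_2$ means that $A_1$ is a compact subset of $A_2$. For $f:G\to\mathbb{R}$, $f_+=\max\{f,0\}$, $f_-=\max\{-f,0\}$, and $\operatorname{supp} f=\overline{\{x: f(x)\neq 0\}}$. $f\gg 0$ means that $f$ is positive definite: $\sum_{n,m=1}^N c_n\overline{c_m} f(x_n-x_m)\ge 0$ for all $N\in\mathbb{N}$, $x_1,\dots,x_N\in G$, $c_1,\dots,c_N\in\mathbb{C}$. For real-valued functions put $$\mathcal{F}_1(\Omega_+,\Omega_-):=\{f\in C(G)\cap L^1(G): f\gg 0,\ f(0)=1,\ \operatorname{supp} f_+\subset\Omega_+,\ \operatorname{supp} f_-\subset\Omega_-\},$$ $$\mathcal{F}_c(\Omega_+,\Omega_-):=\{f\in C(G): f\gg 0,\ f(0)=1,\ \operatorname{supp} f_+\Subset\Omega_+,\ \operatorname{supp} f_-\Subset\Omega_-\},$$ and $$\mathcal{C}_1(\Omega_+,\Omega_-):=\sup\Big\{\int_G f: f\in\mathcal{F}_1(\Omega_+,\Omega_-)\Big\},\quad \mathcal{C}_c(\Omega_+,\Omega_-):=\sup\Big\{\int_G f: f\in\mathcal{F}_c(\Omega_+,\Omega_-)\Big\},$$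 where the supremum over an empty class is interpreted as $0$. *)

theory Defs
  imports "HOL-Analysis.Analysis"
begin

(* The group G is a type of sort topological_ab_group_add + t2_space (locally compact groups are
   Hausdorff by convention); local compactness is a separate hypothesis of the results.

   Haar measure: a nonzero translation-invariant Radon measure on the Borel sets, i.e. finite on
   compact sets, outer regular on Borel sets and inner regular on open sets.  Inner regularity is
   not required on all Borel sets, since G need not be sigma-compact. *)
definition haar_measure :: "'a::{topological_ab_group_add,t2_space} measure \<Rightarrow> bool" where
  "haar_measure M \<longleftrightarrow>
     sets M = sets borel \<and>
     emeasure M UNIV \<noteq> 0 \<and>
     (\<forall>K. compact K \<longrightarrow> emeasure M K < \<infinity>) \<and>
     (\<forall>A\<in>sets borel. emeasure M A = (INF U\<in>{U. open U \<and> A \<subseteq> U}. emeasure M U)) \<and>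
     (\<forall>U. open U \<longrightarrow> emeasure M U = (SUP K\<in>{K. compact K \<and> K \<subseteq> U}. emeasure M K)) \<and>
     (\<forall>a. \<forall>A\<in>sets borel. emeasure M ((+) a ` A) = emeasure M A)"

definition zero_symmetric :: "'a::ab_group_add set \<Rightarrow> bool" where
  "zero_symmetric A \<longleftrightarrow> A = uminus ` A"

definition fun_supp :: "('a::topological_space \<Rightarrow> real) \<Rightarrow> 'a set" where
  "fun_supp f = closure {x. f x \<noteq> 0}"

definition pos_part :: "('a \<Rightarrow> real) \<Rightarrow> 'a \<Rightarrow> real" where
  "pos_part f = (\<lambda>x. max (f x) 0)"

definition neg_part :: "('a \<Rightarrow> real) \<Rightarrow> 'a \<Rightarrow> real" where
  "neg_part f = (\<lambda>x. max (- f x) 0)"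

definition positive_definite :: "('a::ab_group_add \<Rightarrow> real) \<Rightarrow> bool" where
  "positive_definite f \<longleftrightarrow>
     (\<forall>N (x :: nat \<Rightarrow> 'a) (c :: nat \<Rightarrow> complex).
        (\<Sum>n=1..N. \<Sum>m=1..N. c n * cnj (c m) * complex_of_real (f (x n - x m))) \<in> \<real>\<^sub>\<ge>\<^sub>0)"

definition class_F1 ::
  "'a::{topological_ab_group_add,t2_space} measure \<Rightarrow> 'a set \<Rightarrow> 'a set \<Rightarrow> ('a \<Rightarrow> real) set" where
  "class_F1 M \<Omega>p \<Omega>m =
     {f. continuous_on UNIV f \<and> integrable M f \<and> positive_definite f \<and> f 0 = 1 \<and>
         fun_supp (pos_part f) \<subseteq> \<Omega>p \<and> fun_supp (neg_part f) \<subseteq> \<Omega>m}"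

definition class_Fc ::
  "'a::{topological_ab_group_add,t2_space} set \<Rightarrow> 'a set \<Rightarrow> ('a \<Rightarrow> real) set" where
  "class_Fc \<Omega>p \<Omega>m =
     {f. continuous_on UNIV f \<and> positive_definite f \<and> f 0 = 1 \<and>
         compact (fun_supp (pos_part f)) \<and> fun_supp (pos_part f) \<subseteq> \<Omega>p \<and>
         compact (fun_supp (neg_part f)) \<and> fun_supp (neg_part f) \<subseteq> \<Omega>m}"

(* The suprema may be infinite, hence ereal.  The empty class needs its own case because the
   supremum of the empty set in ereal is minus infinity. *)
definition sup_integral :: "'a measure \<Rightarrow> ('a \<Rightarrow> real) set \<Rightarrow> ereal" where
  "sup_integral M F = (if F = {} then 0 else (SUP f\<in>F. ereal (\<integral>x. f x \<partial>M)))"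

definition const_C1 ::
  "'a::{topological_ab_group_add,t2_space} measure \<Rightarrow> 'a set \<Rightarrow> 'a set \<Rightarrow> ereal" where
  "const_C1 M \<Omega>p \<Omega>m = sup_integral M (class_F1 M \<Omega>p \<Omega>m)"

definition const_Cc ::
  "'a::{topological_ab_group_add,t2_space} measure \<Rightarrow> 'a set \<Rightarrow> 'a set \<Rightarrow> ereal" where
  "const_Cc M \<Omega>p \<Omega>m = sup_integral M (class_Fc \<Omega>p \<Omega>m)"

end

theory Submission
  imports Defs "HOL-Real_Asymp.Real_Asymp"
begin

text \<open>
  The inequality \<open>\<ge>\<close> holds because \<open>class_Fc\<close> is contained in \<open>class_F1\<close>.  For the converse, an
  integrable \<open>f\<close> is multiplied by a continuous, compactly supported \<open>k\<close> with \<open>0 \<le> k \<le> 1\<close> and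
  \<open>k 0 = 1\<close>, such that \<open>f \<cdot> k\<close> is again positive definite and \<open>k\<close> is close to 1 on a compact set that
  carries almost all of the integral of \<open>\<bar>f\<bar>\<close>.  As \<open>k \<ge> 0\<close>, the product keeps the sign conditions on
  the supports, and its integral is close to that of \<open>f\<close>.  In particular the two classes are empty
  simultaneously, so that the convention for empty classes is applied on both sides or on neither.

  The function \<open>k\<close> (\<open>positive_definite_approximate_unit\<close>) is a normalized autocorrelation
  \<open>x \<mapsto> \<integral> h (x + t) h t dt\<close>.  Multiplying by it preserves positive definiteness: the quadratic form
  of the product is an integral over \<open>t\<close> of quadratic forms of \<open>f\<close> with the coefficients
  \<open>c\<^sub>n h (x\<^sub>n + t)\<close> (\<open>positive_definite_mult_autocorrelation\<close>).  It is close to 1 on a given compact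
  set \<open>K\<close> if \<open>h\<close> lies between the indicators of two sets of a Foelner sequence
  (\<open>foelner_sets\<close>).  Such sets exist because the group is abelian: if \<open>L\<close> is a compact
  neighbourhood of 0 containing \<open>K\<close> and \<open>L + L\<close> is covered by the translates of \<open>L\<close> by a finite set
  \<open>F\<close>, then the \<open>(n + 1)\<close>-fold sumset of \<open>L\<close> is covered by at most \<open>(n + 1) ^ card F\<close> translates of
  \<open>L\<close>.  The measures of the iterated sumsets thus grow polynomially, and so the ratio of the terms
  of index \<open>n + 2\<close> and \<open>n\<close> comes arbitrarily close to 1 for suitable \<open>n\<close>.
\<close>

section \<open>Iterated sumsets and their polynomial growth\<close>

text \<open>The \<open>n\<close>-fold sumset \<open>K + \<dots> + K\<close>; for \<open>n = 0\<close> it is \<open>{0}\<close>.\<close>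

primrec sumset_power :: "'a::ab_group_add set \<Rightarrow> nat \<Rightarrow> 'a set" where
  "sumset_power K 0 = {0}"
| "sumset_power K (Suc n) = (\<lambda>(x, y). x + y) ` (K \<times> sumset_power K n)"

lemma sumset_power_SucI: "x \<in> K \<Longrightarrow> y \<in> sumset_power K n \<Longrightarrow> x + y \<in> sumset_power K (Suc n)"
  by (simp only: sumset_power.simps(2)) (rule image_eqI[where x = "(x, y)"], simp_all)

lemma compact_sumset_power:
  fixes K :: "'a::topological_ab_group_add set"
  assumes "compact K"
  shows "compact (sumset_power K n)"
proof (induction n)
  case (Suc n)
  have "continuous_on (K \<times> sumset_power K n) (\<lambda>(x, y). x + y)"
    unfolding split_def by (intro continuous_intros)
  with Suc assms show ?case
    by (auto intro!: compact_continuous_image compact_Times)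
qed auto

lemma open_translate:
  fixes U :: "'a::topological_ab_group_add set"
  assumes "open U"
  shows "open ((+) a ` U)"
proof -
  have "(+) a ` U = (\<lambda>x. x - a) -` U"
    by (auto intro!: image_eqI[where x = "x - a" for x])
  moreover have "open ((\<lambda>x. x - a) -` U)"
    by (intro open_vimage assms continuous_intros)
  ultimately show ?thesis by simp
qed

lemma sumset_power_subset_interior:
  fixes K :: "'a::topological_ab_group_add set"
  assumes "0 \<in> interior K"
  shows "sumset_power K n \<subseteq> interior (sumset_power K (Suc n))"
proof
  fix x assume x: "x \<in> sumset_power K n"
  have "(+) x ` interior K \<subseteq> sumset_power K (Suc n)"
    using x interior_subset[of K] sumset_power_SucI[OF _ x] by (auto simp: add.commute[of x])
  moreover have "open ((+) x ` interior K)"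
    by (intro open_translate) simp
  moreover have "x \<in> (+) x ` interior K"
    using assms by (auto intro!: image_eqI[where x = 0])
  ultimately show "x \<in> interior (sumset_power K (Suc n))"
    using interiorI by blast
qed

lemma compact_sum_finite_cover:
  fixes K :: "'a::topological_ab_group_add set"
  assumes "compact K" "0 \<in> interior K"
  obtains F where "finite F" "\<And>x y. x \<in> K \<Longrightarrow> y \<in> K \<Longrightarrow> \<exists>a\<in>F. \<exists>z\<in>K. x + y = a + z"
proof -
  have "compact (sumset_power K 2)"
    by (intro compact_sumset_power assms)
  moreover have "\<And>a. open ((+) a ` interior K)"
    by (intro open_translate) simp
  moreover have "sumset_power K 2 \<subseteq> (\<Union>a\<in>UNIV. (+) a ` interior K)"
  proof
    fix x show "x \<in> (\<Union>a\<in>UNIV. (+) a ` interior K)"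
      using assms(2) by (auto intro!: exI[of _ x] image_eqI[where x = 0])
  qed
  ultimately obtain F where F: "finite F" "sumset_power K 2 \<subseteq> (\<Union>a\<in>F. (+) a ` interior K)"
    by (rule compactE_image) auto
  show thesis
  proof (rule that[OF F(1)])
    fix x y assume "x \<in> K" "y \<in> K"
    then have "x + y \<in> sumset_power K 2"
      using sumset_power_SucI[of x K y 1] sumset_power_SucI[of y K 0 0]
      by (simp add: numeral_2_eq_2 del: sumset_power.simps(2))
    with F(2) show "\<exists>a\<in>F. \<exists>z\<in>K. x + y = a + z"
      using interior_subset[of K] by blast
  qed
qed

text \<open>
  The set of all sums over \<open>a \<in> F\<close> of \<open>j a\<close> copies of \<open>a\<close>, with multiplicities \<open>j a \<le> n\<close>.  For finite
  \<open>F\<close> it contains every sum of \<open>n\<close> elements of \<open>F\<close>: by commutativity only the multiplicities matter,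
  which makes the number of such sums polynomial in \<open>n\<close>.
\<close>

definition multiplicity_sums :: "'a::ab_group_add set \<Rightarrow> nat \<Rightarrow> 'a set" where
  "multiplicity_sums F n = (\<lambda>j. \<Sum>a\<in>F. \<Sum>i<j a. a) ` (F \<rightarrow>\<^sub>E {..n})"

lemma finite_multiplicity_sums: "finite F \<Longrightarrow> finite (multiplicity_sums F n)"
  unfolding multiplicity_sums_def by (intro finite_imageI finite_PiE) auto

lemma card_multiplicity_sums:
  assumes "finite F"
  shows "card (multiplicity_sums F n) \<le> (n + 1) ^ card F"
proof -
  have "card (multiplicity_sums F n) \<le> card (F \<rightarrow>\<^sub>E {..n})"
    unfolding multiplicity_sums_def by (intro card_image_le finite_PiE assms) auto
  also have "\<dots> = (n + 1) ^ card F"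
    using assms by (simp add: card_PiE)
  finally show ?thesis .
qed

lemma multiplicity_sums_0: "0 \<in> multiplicity_sums F 0"
  unfolding multiplicity_sums_def
  by (rule image_eqI[where x = "\<lambda>a\<in>F. 0"]) simp_all

lemma multiplicity_sums_Suc:
  assumes "finite F" "v \<in> multiplicity_sums F n" "a \<in> F"
  shows "v + a \<in> multiplicity_sums F (Suc n)"
proof -
  obtain j where j: "j \<in> F \<rightarrow>\<^sub>E {..n}" "v = (\<Sum>b\<in>F. \<Sum>i<j b. b)"
    using assms(2) by (auto simp: multiplicity_sums_def)
  define j' where "j' = j(a := Suc (j a))"
  have "j' \<in> F \<rightarrow>\<^sub>E {..Suc n}"
  proof (rule PiE_I)
    fix b assume "b \<in> F"
    then have "j b \<le> n" using PiE_mem[OF j(1)] by simp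
    then show "j' b \<in> {..Suc n}" by (simp add: j'_def) (use assms(3) PiE_mem[OF j(1), of a] in simp)
  next
    fix b assume "b \<notin> F"
    moreover from this have "b \<noteq> a" using assms(3) by metis
    ultimately show "j' b = undefined" using PiE_arb[OF j(1)] by (simp add: j'_def)
  qed
  moreover have "(\<Sum>b\<in>F. \<Sum>i<j' b. b) = v + a"
  proof -
    have "(\<Sum>b\<in>F - {a}. \<Sum>i<j' b. b) = (\<Sum>b\<in>F - {a}. \<Sum>i<j b. b)"
      by (rule sum.cong) (auto simp: j'_def)
    moreover have "(\<Sum>b\<in>F. \<Sum>i<j' b. b) = (\<Sum>i<j' a. a) + (\<Sum>b\<in>F - {a}. \<Sum>i<j' b. b)"
      by (rule sum.remove[OF assms(1,3)])
    moreover have "v = (\<Sum>i<j a. a) + (\<Sum>b\<in>F - {a}. \<Sum>i<j b. b)"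
      unfolding j(2) by (rule sum.remove[OF assms(1,3)])
    moreover have "(\<Sum>i<j' a. a) = a + (\<Sum>i<j a. a)"
      by (simp add: j'_def add.commute)
    ultimately show ?thesis
      by (simp only: add_ac)
  qed
  ultimately show ?thesis
    unfolding multiplicity_sums_def by (intro image_eqI[where x = j']) simp_all
qed

lemma sumset_power_cover:
  fixes K :: "'a::ab_group_add set"
  assumes "finite F" and F: "\<And>x y. x \<in> K \<Longrightarrow> y \<in> K \<Longrightarrow> \<exists>a\<in>F. \<exists>z\<in>K. x + y = a + z"
  shows "sumset_power K (Suc n) \<subseteq> (\<Union>v\<in>multiplicity_sums F n. (+) v ` K)"
proof (induction n)
  case 0
  show ?case using multiplicity_sums_0[of F] by force
next
  case (Suc n)
  show ?case
  proof
    fix w assume "w \<in> sumset_power K (Suc (Suc n))"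
    then have "w \<in> (\<lambda>(x, y). x + y) ` (K \<times> sumset_power K (Suc n))"
      by (simp only: sumset_power.simps(2))
    then obtain x y where "x \<in> K" "y \<in> sumset_power K (Suc n)" "w = x + y"
      by (elim imageE) (auto simp del: sumset_power.simps)
    moreover from this Suc obtain v z where vz: "v \<in> multiplicity_sums F n" "z \<in> K" "y = v + z"
      by blast
    moreover obtain a z' where "a \<in> F" "z' \<in> K" "x + z = a + z'"
      using F calculation by blast
    moreover have "w = (v + a) + z'"
      using calculation by (metis add.assoc add.commute)
    ultimately have "w = (v + a) + z'" "v + a \<in> multiplicity_sums F (Suc n)" "z' \<in> K"
      using multiplicity_sums_Suc[OF assms(1)] by blast+
    then show "w \<in> (\<Union>v\<in>multiplicity_sums F (Suc n). (+) v ` K)" by blast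
  qed
qed

text \<open>
  If every ratio exceeded \<open>1 + e\<close>, then the subsequence of odd index would grow exponentially.
\<close>

lemma polynomial_growth_imp_small_ratio:
  fixes a :: "nat \<Rightarrow> real"
  assumes pos: "\<And>n. n \<ge> 1 \<Longrightarrow> a n > 0" and bound: "\<And>n. a (Suc n) \<le> C * real (n + 1) ^ r"
    and "e > 0"
  shows "\<exists>n\<ge>1. a (n + 2) \<le> (1 + e) * a n"
proof (rule ccontr)
  assume "\<not> ?thesis"
  then have step: "(1 + e) * a n < a (n + 2)" if "n \<ge> 1" for n
    using that by (meson not_le)
  have low: "(1 + e) ^ j * a 1 \<le> a (2 * j + 1)" for j
  proof (induction j)
    case (Suc j)
    have "(1 + e) ^ Suc j * a 1 \<le> (1 + e) * a (2 * j + 1)"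
      using Suc \<open>e > 0\<close> by (simp add: mult.assoc)
    also have "\<dots> \<le> a (2 * Suc j + 1)"
      using step[of "2 * j + 1"] by simp
    finally show ?case .
  qed simp
  have *: "a 1 \<le> C * (real (2 * j + 1) ^ r / (1 + e) ^ j)" for j
  proof -
    have "(1 + e) ^ j * a 1 \<le> C * real (2 * j + 1) ^ r"
      using low[of j] bound[of "2 * j"] by simp
    then show ?thesis using \<open>e > 0\<close> by (simp add: field_simps)
  qed
  have lim: "(\<lambda>j. real (2 * j + 1) ^ r / (1 + e) ^ j) \<longlonglongrightarrow> 0"
    using \<open>e > 0\<close> by real_asymp
  have "a 1 \<le> C * 0"
    by (rule tendsto_le[OF trivial_limit_sequentially tendsto_mult[OF tendsto_const lim] tendsto_const])
       (use * in auto)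
  with pos[of 1] show False by simp
qed

section \<open>Haar measure\<close>

lemma haar_measure_sets: "haar_measure M \<Longrightarrow> sets M = sets borel"
  unfolding haar_measure_def by (elim conjE)

lemma haar_space: "haar_measure M \<Longrightarrow> space M = UNIV"
  using sets_eq_imp_space_eq[OF haar_measure_sets, of M] by simp

lemma haar_nonzero: "haar_measure M \<Longrightarrow> emeasure M UNIV \<noteq> 0"
  unfolding haar_measure_def by (elim conjE)

lemma haar_compact_finite: "haar_measure M \<Longrightarrow> compact K \<Longrightarrow> emeasure M K < \<infinity>"
  unfolding haar_measure_def by (elim conjE) (erule allE[of _ K], erule mp, assumption)

lemma haar_translate: "haar_measure M \<Longrightarrow> A \<in> sets borel \<Longrightarrow> emeasure M ((+) a ` A) = emeasure M A"
  unfolding haar_measure_def by (elim conjE) (erule allE[of _ a], erule bspec, assumption)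

lemma haar_inner_regular:
  "haar_measure M \<Longrightarrow> open U \<Longrightarrow> emeasure M U = (SUP K\<in>{K. compact K \<and> K \<subseteq> U}. emeasure M K)"
  unfolding haar_measure_def by (elim conjE) (erule allE[of _ U], erule mp, assumption)

lemma haar_borel_measurable:
  assumes "haar_measure M" "continuous_on UNIV f"
  shows "f \<in> borel_measurable M"
  using borel_measurable_continuous_onI[OF assms(2)]
  by (simp only: measurable_cong_sets[OF haar_measure_sets[OF assms(1)] refl])

lemma haar_distr_translate:
  fixes M :: "'a::{topological_ab_group_add,t2_space} measure"
  assumes M: "haar_measure M"
  shows "distr M borel ((+) a) = M"
proof (rule measure_eqI)
  show "sets (distr M borel ((+) a)) = sets M"
    using haar_measure_sets[OF M] by simp
  fix A assume "A \<in> sets (distr M borel ((+) a))"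
  then have A: "A \<in> sets borel" by simp
  have meas: "(+) a \<in> measurable M borel"
    by (rule haar_borel_measurable[OF M]) (intro continuous_intros)
  have "(+) a -` A = (+) (- a) ` A"
  proof
    show "(+) a -` A \<subseteq> (+) (- a) ` A"
      by (auto intro!: image_eqI[where x = "a + x" for x])
  qed auto
  moreover have "emeasure (distr M borel ((+) a)) A = emeasure M ((+) a -` A)"
    by (simp only: emeasure_distr[OF meas A] haar_space[OF M] Int_UNIV_right)
  ultimately show "emeasure (distr M borel ((+) a)) A = emeasure M A"
    by (simp only: haar_translate[OF M A])
qed

lemma haar_integral_translate:
  fixes M :: "'a::{topological_ab_group_add,t2_space} measure"
    and g :: "'a \<Rightarrow> 'b::{banach, second_countable_topology}"
  assumes M: "haar_measure M" and g: "g \<in> borel_measurable M"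
  shows "(\<integral>t. g (a + t) \<partial>M) = (\<integral>t. g t \<partial>M)"
proof -
  have "(+) a \<in> measurable M borel"
    by (rule haar_borel_measurable[OF M]) (intro continuous_intros)
  moreover have "g \<in> borel_measurable borel"
    using g by (simp only: measurable_cong_sets[OF haar_measure_sets[OF M] refl])
  ultimately have "(\<integral>t. g t \<partial>distr M borel ((+) a)) = (\<integral>t. g (a + t) \<partial>M)"
    by (rule integral_distr)
  then show ?thesis by (simp add: haar_distr_translate[OF M])
qed

lemma haar_integrable_compact_support:
  fixes f :: "'a::{topological_ab_group_add,t2_space} \<Rightarrow> 'b::{banach, second_countable_topology}"
  assumes M: "haar_measure M" and f: "continuous_on UNIV f"
    and K: "compact K" "\<And>x. x \<notin> K \<Longrightarrow> f x = 0"
  shows "integrable M f"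
proof -
  have "compact (f ` K)"
    using f K(1) by (meson compact_continuous_image continuous_on_subset top_greatest)
  then obtain B where B: "\<And>x. x \<in> K \<Longrightarrow> norm (f x) \<le> B"
    by (meson compact_imp_bounded bounded_iff imageI)
  have Kset: "K \<in> sets M"
    using K(1) haar_measure_sets[OF M] by (simp add: compact_imp_closed)
  have "integrable M (\<lambda>x. B * indicator K x)"
    using haar_compact_finite[OF M K(1)] Kset by (intro integrable_mult_right integrable_real_indicator)
  then show ?thesis
  proof (rule Bochner_Integration.integrable_bound)
    show "AE x in M. norm (f x) \<le> norm (B * indicator K x)"
    proof (rule AE_I2)
      fix x
      show "norm (f x) \<le> norm (B * indicator K x)"
        using B[of x] K(2)[of x] by (cases "x \<in> K") auto
    qed
  qed (rule haar_borel_measurable[OF M f])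
qed

lemma haar_compact_positive:
  assumes M: "haar_measure M"
  obtains C where "compact C" "emeasure M C > 0"
proof -
  have "emeasure M UNIV > 0"
    using haar_nonzero[OF M] by (simp only: zero_less_iff_neq_zero not_False_eq_True)
  then have "(SUP K\<in>{K. compact K \<and> K \<subseteq> UNIV}. emeasure M K) > 0"
    by (rule ord_less_eq_trans) (rule haar_inner_regular[OF M open_UNIV])
  then show thesis using that by (auto simp: less_SUP_iff)
qed

lemma measure_sumset_power_le:
  fixes M :: "'a::{topological_ab_group_add,t2_space} measure"
  assumes M: "haar_measure M" and K: "compact K" and fin: "finite F"
    and F: "\<And>x y. x \<in> K \<Longrightarrow> y \<in> K \<Longrightarrow> \<exists>a\<in>F. \<exists>z\<in>K. x + y = a + z"
  shows "measure M (sumset_power K (Suc n)) \<le> measure M K * real (n + 1) ^ card F"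
proof -
  let ?V = "multiplicity_sums F n"
  note finV = finite_multiplicity_sums[OF fin, of n]
  have tr: "compact ((+) v ` K)" for v
    by (intro compact_continuous_image K continuous_intros)
  have sets: "A \<in> sets M" if "compact A" for A
    using that haar_measure_sets[OF M] by (simp add: compact_imp_closed)
  have fm: "A \<in> fmeasurable M" if "compact A" for A
    using that by (intro fmeasurableI sets haar_compact_finite[OF M])
  have "measure M (sumset_power K (Suc n)) \<le> measure M (\<Union>v\<in>?V. (+) v ` K)"
    using sumset_power_cover[OF fin F, of n] compact_sumset_power[OF K, of "Suc n"] tr finV
    by (intro measure_mono_fmeasurable sets fm compact_UN) auto
  also have "\<dots> \<le> (\<Sum>v\<in>?V. measure M ((+) v ` K))"
    using finV tr by (intro measure_UNION_le sets)
  also have "\<dots> = (\<Sum>v\<in>?V. measure M K)"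
    using K by (simp add: measure_def haar_translate[OF M] compact_imp_closed)
  also have "\<dots> = measure M K * real (card ?V)" by simp
  also have "\<dots> \<le> measure M K * real (n + 1) ^ card F"
  proof (rule mult_left_mono)
    have "real (card ?V) \<le> real ((n + 1) ^ card F)"
      using card_multiplicity_sums[OF fin, of n] by (subst of_nat_le_iff)
    then show "real (card ?V) \<le> real (n + 1) ^ card F" by simp
  qed simp
  finally show ?thesis .
qed

lemma Hausdorff_space_euclidean_t2: "Hausdorff_space (euclidean :: 'a::t2_space topology)"
  unfolding Hausdorff_space_def by (auto simp: disjnt_def) (metis hausdorff)

lemma locally_compact_neighbourhood:
  fixes C :: "'a::t2_space set"
  assumes "locally_compact_space (euclidean :: 'a topology)" "compact C"
  obtains L where "compact L" "C \<subseteq> interior L"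
proof -
  obtain U L where "open U" "compact L" "C \<subseteq> U" "U \<subseteq> L"
    using assms Hausdorff_space_euclidean_t2[where 'a = 'a]
    by (auto simp: locally_compact_space_compact_closed_compact)
  then show thesis using that by (meson interior_maximal order_trans)
qed

text \<open>
  With \<open>L\<close> a compact neighbourhood of 0 that contains \<open>K\<close>, the sets \<open>A\<close>, \<open>B\<close>, \<open>C\<close> are three consecutive
  iterated sumsets of \<open>L\<close>.  The gap between \<open>A\<close> and \<open>B\<close> absorbs translations by \<open>K\<close>, the one between
  \<open>B\<close> and \<open>C\<close> leaves room for a continuous cut-off function.
\<close>

lemma foelner_sets:
  fixes M :: "'a::{topological_ab_group_add,t2_space} measure" and K :: "'a set"
  assumes lc: "locally_compact_space (euclidean :: 'a topology)" and M: "haar_measure M"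
    and K: "compact K" and "e > 0"
  obtains A B C :: "'a set" where "compact A" "compact B" "compact C" "B \<subseteq> interior C"
    "\<And>x t. x \<in> K \<Longrightarrow> t \<in> A \<Longrightarrow> x + t \<in> B" "A \<subseteq> B"
    "measure M A > 0" "measure M C \<le> (1 + e) * measure M A"
proof -
  \<comment> \<open>A compact set of positive measure is put into \<open>L\<close>, so that all sumsets have positive measure.\<close>
  obtain P where P: "compact P" "emeasure M P > 0"
    using haar_compact_positive[OF M] .
  obtain L where L: "compact L" "insert 0 (P \<union> K) \<subseteq> interior L"
    by (rule locally_compact_neighbourhood[OF lc, of "insert 0 (P \<union> K)"])
       (use P(1) K in \<open>auto intro: compact_insert compact_Un\<close>)
  then have L': "0 \<in> L" "P \<subseteq> L" "K \<subseteq> L" "0 \<in> interior L"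
    using interior_subset[of L] by auto
  obtain F where F: "finite F" "\<And>x y. x \<in> L \<Longrightarrow> y \<in> L \<Longrightarrow> \<exists>a\<in>F. \<exists>z\<in>L. x + y = a + z"
    using compact_sum_finite_cover[OF L(1) L'(4)] by metis
  note cpt = compact_sumset_power[OF L(1)]
  have fm: "A \<in> fmeasurable M" if "compact A" for A
    using that haar_measure_sets[OF M]
    by (intro fmeasurableI haar_compact_finite[OF M]) (auto simp: compact_imp_closed)
  have mono: "sumset_power L n \<subseteq> sumset_power L (Suc n)" for n
    using sumset_power_subset_interior[OF L'(4)] interior_subset by blast
  have "measure M P > 0"
    using P haar_compact_finite[OF M P(1)] by (simp add: measure_def enn2real_positive_iff)
  moreover have "P \<subseteq> sumset_power L n" if "n \<ge> 1" for n
    using that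
  proof (induction n rule: dec_induct)
    case base
    show ?case using L'(2) by force
  next
    case (step n)
    then show ?case using mono[of n] by blast
  qed
  ultimately have pos: "measure M (sumset_power L n) > 0" if "n \<ge> 1" for n
    using that measure_mono_fmeasurable[OF _ fmeasurableD[OF fm[OF P(1)]] fm[OF cpt[of n]]]
    by fastforce
  from polynomial_growth_imp_small_ratio[of "\<lambda>n. measure M (sumset_power L n)",
      OF pos measure_sumset_power_le[OF M L(1) F] \<open>e > 0\<close>]
  obtain n where n: "n \<ge> 1"
    "measure M (sumset_power L (n + 2)) \<le> (1 + e) * measure M (sumset_power L n)" by auto
  show thesis
  proof (rule that[OF cpt[of n] cpt[of "Suc n"] cpt[of "n + 2"]])
    show "sumset_power L (Suc n) \<subseteq> interior (sumset_power L (n + 2))"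
      using sumset_power_subset_interior[OF L'(4), of "Suc n"] by simp
    show "x + t \<in> sumset_power L (Suc n)" if "x \<in> K" "t \<in> sumset_power L n" for x t
      using that L'(3) by (intro sumset_power_SucI) auto
  qed (use n pos mono in auto)
qed

section \<open>Autocorrelations\<close>

text \<open>
  The convolution of \<open>h\<close> with its reflection, for real-valued \<open>h\<close>.
\<close>

definition autocorrelation :: "'a::{topological_ab_group_add,t2_space} measure \<Rightarrow> ('a \<Rightarrow> real) \<Rightarrow> 'a \<Rightarrow> real" where
  "autocorrelation M h x = (\<integral>t. h (x + t) * h t \<partial>M)"

lemma continuous_on_translate:
  fixes h :: "'a::topological_ab_group_add \<Rightarrow> 'b::topological_space"
  assumes "continuous_on UNIV h"
  shows "continuous_on A (\<lambda>t. h (x + t))"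
  by (rule continuous_on_compose2[OF assms]) (auto intro!: continuous_intros)

lemma autocorrelation_integrable:
  fixes M :: "'a::{topological_ab_group_add,t2_space} measure"
  assumes M: "haar_measure M" and h: "continuous_on UNIV h"
    and S: "compact S" "\<And>t. t \<notin> S \<Longrightarrow> h t = 0"
  shows "integrable M (\<lambda>t. h (x + t) * h t :: real)"
  by (rule haar_integrable_compact_support[OF M _ S(1)])
     (use S(2) in \<open>auto intro!: continuous_on_mult continuous_on_translate h\<close>)

text \<open>
  Dominated convergence is not available here, since points of the group need not have countable
  neighbourhood bases; instead, \<open>h (x + t)\<close> is continuous in \<open>x\<close> uniformly over \<open>t\<close> in the compact set
  \<open>S\<close>.
\<close>

lemma continuous_on_autocorrelation:
  fixes M :: "'a::{topological_ab_group_add,t2_space} measure"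
  assumes M: "haar_measure M" and h: "continuous_on UNIV h"
    and S: "compact S" "\<And>t. t \<notin> S \<Longrightarrow> h t = 0"
  shows "continuous_on UNIV (autocorrelation M h)"
proof -
  note int = autocorrelation_integrable[OF M h S]
  have inth: "integrable M (\<lambda>t. \<bar>h t\<bar>)"
    by (intro integrable_abs haar_integrable_compact_support[OF M h S])
  define I where "I = (\<integral>t. \<bar>h t\<bar> \<partial>M)"
  have I: "I \<ge> 0" unfolding I_def by simp
  have cont: "continuous_on (UNIV \<times> S) (\<lambda>(x, t). h (x + t))"
    unfolding split_def by (rule continuous_on_compose2[OF h]) (auto intro!: continuous_intros)
  have "(autocorrelation M h \<longlongrightarrow> autocorrelation M h x0) (at x0)" for x0
  proof (rule tendstoI)
    fix e :: real assume e: "e > 0"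
    define d where "d = e / (I + 1)"
    have d: "d > 0" using e I by (simp add: d_def)
    obtain X where X: "x0 \<in> X" "open X"
      "\<forall>x\<in>X \<inter> UNIV. \<forall>t\<in>S. dist (case (x, t) of (x, t) \<Rightarrow> h (x + t)) (case (x0, t) of (x, t) \<Rightarrow> h (x + t)) \<le> d"
      using continuous_on_prod_compactE[OF cont S(1) UNIV_I d] by metis
    have "dist (autocorrelation M h x) (autocorrelation M h x0) < e" if x: "x \<in> X" for x
    proof -
      have "\<bar>h (x + t) * h t - h (x0 + t) * h t\<bar> \<le> d * \<bar>h t\<bar>" for t
      proof (cases "t \<in> S")
        case True
        then have "\<bar>h (x + t) - h (x0 + t)\<bar> \<le> d"
          using X(3) x by (auto simp: dist_real_def)
        then have "\<bar>h (x + t) - h (x0 + t)\<bar> * \<bar>h t\<bar> \<le> d * \<bar>h t\<bar>"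
          by (rule mult_right_mono) simp
        then show ?thesis by (simp add: abs_mult[symmetric] left_diff_distrib)
      qed (simp add: S(2))
      then have "(\<integral>t. \<bar>h (x + t) * h t - h (x0 + t) * h t\<bar> \<partial>M) \<le> (\<integral>t. d * \<bar>h t\<bar> \<partial>M)"
        by (intro integral_mono integrable_abs Bochner_Integration.integrable_diff int
            integrable_mult_right inth)
      with integral_abs_bound
      have "\<bar>\<integral>t. h (x + t) * h t - h (x0 + t) * h t \<partial>M\<bar> \<le> (\<integral>t. d * \<bar>h t\<bar> \<partial>M)"
        by (rule order_trans)
      also have "\<dots> = d * I" by (simp add: I_def)
      also have "\<dots> < e"
        using e I by (simp add: d_def field_simps)
      finally show ?thesis
        by (simp add: autocorrelation_def dist_real_def Bochner_Integration.integral_diff[OF int int])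
    qed
    then show "\<forall>\<^sub>F x in at x0. dist (autocorrelation M h x) (autocorrelation M h x0) < e"
      using X(1,2) by (auto simp: eventually_at_topological)
  qed
  then show ?thesis by (simp add: continuous_on_def)
qed

lemma autocorrelation_nonneg: "(\<And>t. h t \<ge> 0) \<Longrightarrow> autocorrelation M h x \<ge> 0"
  unfolding autocorrelation_def by (simp add: integral_nonneg)

lemma autocorrelation_eq_0:
  assumes "\<And>t. t \<notin> S \<Longrightarrow> h t = 0" and "x \<notin> (\<lambda>(s, t). s - t) ` (S \<times> S)"
  shows "autocorrelation M h x = 0"
proof -
  have "h (x + t) * h t = 0" for t
  proof (rule ccontr)
    assume "h (x + t) * h t \<noteq> 0"
    then have "x + t \<in> S" "t \<in> S" using assms(1) by (metis mult_eq_0_iff)+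
    then have "x \<in> (\<lambda>(s, t). s - t) ` (S \<times> S)"
      by (intro image_eqI[where x = "(x + t, t)"]) simp_all
    with assms(2) show False by contradiction
  qed
  then show ?thesis by (simp only: autocorrelation_def integral_zero)
qed

text \<open>
  By the inequality \<open>2 a b \<le> a\<^sup>2 + b\<^sup>2\<close> under the integral, and translation invariance.
\<close>

lemma autocorrelation_le:
  fixes M :: "'a::{topological_ab_group_add,t2_space} measure"
  assumes M: "haar_measure M" and h: "continuous_on UNIV h"
    and S: "compact S" "\<And>t. t \<notin> S \<Longrightarrow> h t = 0"
  shows "autocorrelation M h x \<le> autocorrelation M h 0"
proof -
  have int0: "integrable M (\<lambda>t. h t * h t)"
    using autocorrelation_integrable[OF M h S, of 0] by simp
  have int1: "integrable M (\<lambda>t. h (x + t) * h (x + t))"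
  proof (rule haar_integrable_compact_support[OF M])
    show "compact ((+) (- x) ` S)"
      by (intro compact_continuous_image S(1) continuous_intros)
    fix t assume "t \<notin> (+) (- x) ` S"
    moreover have "t = - x + (x + t)" by simp
    ultimately have "x + t \<notin> S" by blast
    then show "h (x + t) * h (x + t) = 0" by (simp add: S(2))
  qed (intro continuous_on_mult continuous_on_translate h)
  have "(\<integral>t. 2 * (h (x + t) * h t) \<partial>M) \<le> (\<integral>t. h (x + t) * h (x + t) + h t * h t \<partial>M)"
  proof (rule integral_mono)
    fix t
    have "0 \<le> (h (x + t) - h t) * (h (x + t) - h t)" by simp
    then show "2 * (h (x + t) * h t) \<le> h (x + t) * h (x + t) + h t * h t"
      by (simp add: algebra_simps)
  next
    show "integrable M (\<lambda>t. 2 * (h (x + t) * h t))"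
      by (rule integrable_mult_right) (rule autocorrelation_integrable[OF M h S])
    show "integrable M (\<lambda>t. h (x + t) * h (x + t) + h t * h t)"
      by (rule Bochner_Integration.integrable_add[OF int1 int0])
  qed
  also have "\<dots> = (\<integral>t. h (x + t) * h (x + t) \<partial>M) + (\<integral>t. h t * h t \<partial>M)"
    by (rule Bochner_Integration.integral_add[OF int1 int0])
  also have "(\<integral>t. h (x + t) * h (x + t) \<partial>M) = (\<integral>t. h t * h t \<partial>M)"
    by (rule haar_integral_translate[OF M borel_measurable_integrable[OF int0]])
  finally show ?thesis by (simp add: autocorrelation_def)
qed

text \<open>
  A form of the Schur product theorem.  By translation invariance the value of the autocorrelation
  at \<open>x\<^sub>n - x\<^sub>m\<close> is the integral of \<open>h (x\<^sub>n + t) h (x\<^sub>m + t)\<close>, and the second factor is absorbed into the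
  coefficients.
\<close>

lemma positive_definite_mult_autocorrelation:
  fixes M :: "'a::{topological_ab_group_add,t2_space} measure"
  assumes M: "haar_measure M" and h: "continuous_on UNIV h"
    and S: "compact S" "\<And>t. t \<notin> S \<Longrightarrow> h t = 0"
    and f: "positive_definite f"
  shows "positive_definite (\<lambda>x. f x * autocorrelation M h x)"
  unfolding positive_definite_def
proof (intro allI)
  fix N :: nat and x :: "nat \<Rightarrow> 'a" and c :: "nat \<Rightarrow> complex"
  define G where "G n m t = c n * cnj (c m) * complex_of_real (f (x n - x m))
      * complex_of_real (h (x n + t) * h (x m + t))" for n m t
  have int: "integrable M (\<lambda>t. h (x n + t) * h (x m + t))" for n m
  proof (rule haar_integrable_compact_support[OF M])
    show "compact ((+) (- x m) ` S)"
      by (intro compact_continuous_image S(1) continuous_intros)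
    fix t assume "t \<notin> (+) (- x m) ` S"
    moreover have "t = - x m + (x m + t)" by simp
    ultimately have "x m + t \<notin> S" by blast
    then show "h (x n + t) * h (x m + t) = 0" by (simp add: S(2))
  qed (intro continuous_on_mult continuous_on_translate h)
  have ac: "autocorrelation M h (x n - x m) = (\<integral>t. h (x n + t) * h (x m + t) \<partial>M)" for n m
  proof -
    have "(\<integral>t. h (x n - x m + (x m + t)) * h (x m + t) \<partial>M)
        = (\<integral>t. h (x n - x m + t) * h t \<partial>M)"
      by (rule haar_integral_translate[OF M, of "\<lambda>t. h (x n - x m + t) * h t"])
         (intro borel_measurable_integrable autocorrelation_integrable[OF M h S])
    then show ?thesis by (simp add: autocorrelation_def add.assoc[symmetric])
  qed
  have intG: "integrable M (G n m)" for n m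
    unfolding G_def by (intro integrable_mult_right integrable_of_real int)
  have intsum: "integrable M (\<lambda>t. \<Sum>n=1..N. \<Sum>m=1..N. G n m t)"
    by (intro Bochner_Integration.integrable_sum intG)
  have "(\<Sum>n=1..N. \<Sum>m=1..N. c n * cnj (c m)
          * complex_of_real (f (x n - x m) * autocorrelation M h (x n - x m)))
      = (\<Sum>n=1..N. \<Sum>m=1..N. (\<integral>t. G n m t \<partial>M))"
    by (intro sum.cong refl)
       (simp only: G_def ac integral_mult_right_zero integral_complex_of_real of_real_mult[of "f _"] mult.assoc)
  also have "\<dots> = (\<integral>t. (\<Sum>n=1..N. \<Sum>m=1..N. G n m t) \<partial>M)"
    by (simp add: Bochner_Integration.integral_sum intG Bochner_Integration.integrable_sum)
  also have "\<dots> \<in> \<real>\<^sub>\<ge>\<^sub>0"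
  proof -
    have pos: "(\<Sum>n=1..N. \<Sum>m=1..N. G n m t) \<in> \<real>\<^sub>\<ge>\<^sub>0" for t
    proof -
      have "(\<Sum>n=1..N. \<Sum>m=1..N. G n m t)
          = (\<Sum>n=1..N. \<Sum>m=1..N. (c n * complex_of_real (h (x n + t)))
              * cnj (c m * complex_of_real (h (x m + t))) * complex_of_real (f (x n - x m)))"
        by (intro sum.cong refl) (simp add: G_def)
      also have "\<dots> \<in> \<real>\<^sub>\<ge>\<^sub>0"
        using f unfolding positive_definite_def by (elim allE)
      finally show ?thesis .
    qed
    show ?thesis
      unfolding complex_nonneg_Reals_iff
    proof
      show "0 \<le> Re (\<integral>t. (\<Sum>n=1..N. \<Sum>m=1..N. G n m t) \<partial>M)"
        using pos unfolding integral_Re[OF intsum, symmetric] complex_nonneg_Reals_iff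
        by (intro Bochner_Integration.integral_nonneg) blast
      show "Im (\<integral>t. (\<Sum>n=1..N. \<Sum>m=1..N. G n m t) \<partial>M) = 0"
        using pos unfolding integral_Im[OF intsum, symmetric] complex_nonneg_Reals_iff by simp
    qed
  qed
  finally show "(\<Sum>n=1..N. \<Sum>m=1..N. c n * cnj (c m)
          * complex_of_real (f (x n - x m) * autocorrelation M h (x n - x m))) \<in> \<real>\<^sub>\<ge>\<^sub>0" .
qed

lemma positive_definite_scale:
  assumes "positive_definite f" "a \<ge> 0"
  shows "positive_definite (\<lambda>x. f x * a)"
  unfolding positive_definite_def
proof (intro allI)
  fix N :: nat and x :: "nat \<Rightarrow> 'a" and c :: "nat \<Rightarrow> complex"
  have "(\<Sum>n=1..N. \<Sum>m=1..N. c n * cnj (c m) * complex_of_real (f (x n - x m) * a))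
      = (\<Sum>n=1..N. \<Sum>m=1..N. c n * cnj (c m) * complex_of_real (f (x n - x m))) * complex_of_real a"
    by (simp add: sum_distrib_right mult.assoc)
  also have "\<dots> \<in> \<real>\<^sub>\<ge>\<^sub>0"
  proof (rule nonneg_Reals_mult_I)
    show "(\<Sum>n=1..N. \<Sum>m=1..N. c n * cnj (c m) * complex_of_real (f (x n - x m))) \<in> \<real>\<^sub>\<ge>\<^sub>0"
      using assms(1) unfolding positive_definite_def by (elim allE)
    show "complex_of_real a \<in> \<real>\<^sub>\<ge>\<^sub>0" using assms(2) by simp
  qed
  finally show "(\<Sum>n=1..N. \<Sum>m=1..N. c n * cnj (c m) * complex_of_real (f (x n - x m) * a)) \<in> \<real>\<^sub>\<ge>\<^sub>0" .
qed

section \<open>Positive definite approximate units\<close>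

lemma locally_compact_Urysohn:
  fixes B C :: "'a::t2_space set"
  assumes lc: "locally_compact_space (euclidean :: 'a topology)"
    and "compact B" "B \<subseteq> interior C"
  obtains h :: "'a \<Rightarrow> real" where "continuous_on UNIV h" "\<And>x. 0 \<le> h x" "\<And>x. h x \<le> 1"
    "\<And>x. x \<in> B \<Longrightarrow> h x = 1" "\<And>x. x \<notin> C \<Longrightarrow> h x = 0"
proof -
  have "completely_regular_space (euclidean :: 'a topology)"
    using lc Hausdorff_space_euclidean_t2 locally_compact_Hausdorff_imp_regular_space
      locally_compact_regular_imp_completely_regular_space by blast
  moreover have "closedin euclidean (- interior C)" "compactin euclidean B" "disjnt (- interior C) B"
    using assms by (auto simp: disjnt_def closed_closedin[symmetric])
  ultimately obtain g where g: "continuous_map euclidean (top_of_set {0..1::real}) g"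
    "g ` B \<subseteq> {0}" "g ` (- interior C) \<subseteq> {1}"
    using Urysohn_completely_regular_closed_compact[of 0 "1::real" euclidean "- interior C" B]
    by (metis zero_le_one)
  have g': "continuous_on UNIV g" "g x \<in> {0..1}" for x
    using g(1) by (auto simp: continuous_map_in_subtopology)
  show thesis
  proof (rule that[of "\<lambda>x. 1 - g x"])
    show "continuous_on UNIV (\<lambda>x. 1 - g x)"
      by (intro continuous_intros g')
    show "1 - g x = 1" if "x \<in> B" for x using g(2) that by auto
    show "1 - g x = 0" if "x \<notin> C" for x using g(3) that interior_subset[of C] by auto
  qed (use g'(2) in auto)
qed

lemma positive_definite_approximate_unit:
  fixes M :: "'a::{topological_ab_group_add,t2_space} measure" and K :: "'a set"
  assumes lc: "locally_compact_space (euclidean :: 'a topology)" and M: "haar_measure M"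
    and K: "compact K" and e: "e > 0"
  obtains k :: "'a \<Rightarrow> real" and L where "continuous_on UNIV k" "compact L" "\<And>x. x \<notin> L \<Longrightarrow> k x = 0"
    "\<And>x. 0 \<le> k x" "\<And>x. k x \<le> 1" "k 0 = 1" "\<And>x. x \<in> K \<Longrightarrow> k x \<ge> 1 - e"
    "\<And>f. positive_definite f \<Longrightarrow> positive_definite (\<lambda>x. f x * k x)"
proof -
  obtain A B C :: "'a set" where S: "compact A" "compact B" "compact C" "B \<subseteq> interior C"
    and AB: "\<And>x t. x \<in> K \<Longrightarrow> t \<in> A \<Longrightarrow> x + t \<in> B" "A \<subseteq> B"
    and A: "measure M A > 0" "measure M C \<le> (1 + e) * measure M A"
    by (rule foelner_sets[OF lc M K e]) blast
  obtain h where h: "continuous_on UNIV h" "\<And>x. 0 \<le> h x" "\<And>x. h x \<le> (1::real)"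
    "\<And>x. x \<in> B \<Longrightarrow> h x = 1" and h0: "\<And>x. x \<notin> C \<Longrightarrow> h x = 0"
    using locally_compact_Urysohn[OF lc S(2,4)] by metis
  \<comment> \<open>Since \<open>h\<close> is 1 on \<open>B\<close> and vanishes off \<open>C\<close>, the autocorrelation is at least the measure of \<open>A\<close> on
    \<open>K\<close>, and its value \<open>c\<close> at 0 is at most the measure of \<open>C\<close>.\<close>
  define c where "c = autocorrelation M h 0"
  note int = autocorrelation_integrable[OF M h(1) S(3) h0]
  have ind: "integrable M (indicator D :: 'a \<Rightarrow> real)" if "compact D" for D
    using that haar_compact_finite[OF M that] haar_measure_sets[OF M]
    by (intro integrable_real_indicator) (auto simp: compact_imp_closed)
  have mle: "measure M A \<le> autocorrelation M h x" if "\<And>t. t \<in> A \<Longrightarrow> x + t \<in> B" for x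
  proof -
    have "(\<integral>t. indicator A t \<partial>M) \<le> autocorrelation M h x"
      unfolding autocorrelation_def
      by (intro integral_mono ind int S)
         (use that AB(2) h in \<open>auto simp: indicator_def\<close>)
    then show ?thesis by (simp add: haar_space[OF M])
  qed
  have "measure M A \<le> c"
    unfolding c_def by (rule mle) (use AB(2) in auto)
  then have c: "c > 0" using A(1) by simp
  have cle: "c \<le> measure M C"
  proof -
    have "h t * h t \<le> indicator C t" for t
      using h0[of t] h(2,3)[of t] mult_mono[of "h t" 1 "h t" 1] by (auto simp: indicator_def)
    then have "c \<le> (\<integral>t. indicator C t \<partial>M)"
      using int[of 0] unfolding c_def autocorrelation_def add_0_left
      by (intro integral_mono ind S)
    then show ?thesis by (simp add: haar_space[OF M])
  qed
  define k where "k x = autocorrelation M h x * inverse c" for x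
  define L where "L = (\<lambda>(s, t). s - t) ` (C \<times> C)"
  show thesis
  proof (rule that[of k L])
    show "continuous_on UNIV k"
      unfolding k_def
      by (intro continuous_intros continuous_on_autocorrelation[OF M h(1) S(3) h0])
    show "compact L"
      unfolding L_def split_def
      by (intro compact_continuous_image compact_Times S continuous_intros)
    show "k x = 0" if "x \<notin> L" for x
      using that autocorrelation_eq_0[of C h x M] h0 by (simp add: k_def L_def)
    show "0 \<le> k x" for x
      using c by (simp add: k_def autocorrelation_nonneg h)
    show "k x \<le> 1" for x
      using c autocorrelation_le[OF M h(1) S(3) h0, of x]
      by (simp add: k_def c_def[symmetric] field_simps)
    show "k 0 = 1"
      using c by (simp add: k_def c_def[symmetric])
    show "1 - e \<le> k x" if "x \<in> K" for x
    proof -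
      have "(1 - e) * c \<le> measure M A"
      proof (cases "e \<le> 1")
        case True
        have "(1 - e) * c \<le> (1 - e) * ((1 + e) * measure M A)"
          using True cle A(2) by (intro mult_left_mono) auto
        also have "\<dots> = (1 - e * e) * measure M A" by (simp add: algebra_simps)
        also have "\<dots> \<le> 1 * measure M A" by (intro mult_right_mono) auto
        finally show ?thesis by simp
      next
        case False
        then have "(1 - e) * c \<le> 0" using c by (intro mult_nonpos_nonneg) auto
        then show ?thesis using A(1) by simp
      qed
      also have "\<dots> \<le> autocorrelation M h x"
        using that by (intro mle AB)
      finally show ?thesis using c by (simp add: k_def field_simps)
    qed
    show "positive_definite (\<lambda>x. f x * k x)" if "positive_definite f" for f
      using positive_definite_scale[OF positive_definite_mult_autocorrelation[OF M h(1) S(3) h0 that],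
          of "inverse c"] c
      by (simp add: k_def mult.assoc)
  qed
qed

section \<open>Truncating integrable positive definite functions\<close>

text \<open>
  The group need not be \<open>\<sigma>\<close>-compact.  However, the open sets on which \<open>\<bar>f\<bar>\<close> lies strictly between
  \<open>1 / (n + 1)\<close> and \<open>n + 1\<close> have finite measure and exhaust the set where \<open>f\<close> does not vanish; inner
  regularity on one of them gives \<open>K\<close>.
\<close>

lemma integrable_continuous_tight:
  fixes M :: "'a::{topological_ab_group_add,t2_space} measure" and f :: "'a \<Rightarrow> real"
  assumes M: "haar_measure M" and f: "continuous_on UNIV f" "integrable M f" and e: "e > 0"
  obtains K where "compact K" "(\<integral>x. \<bar>f x\<bar> * indicator (- K) x \<partial>M) \<le> e"
proof -
  define A where "A n = {x. 1 < real (Suc n) * \<bar>f x\<bar> \<and> \<bar>f x\<bar> < real (Suc n)}" for n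
  have opn: "open (A n)" for n
    unfolding A_def by (intro open_Collect_conj open_Collect_less continuous_intros f)
  have borel: "D \<in> sets M" if "open D \<or> closed D" for D
    unfolding haar_measure_sets[OF M] using that borel_open borel_closed by blast
  have intf: "integrable M (\<lambda>x. \<bar>f x\<bar>)" using f(2) by (rule integrable_abs)
  have intD: "integrable M (\<lambda>x. \<bar>f x\<bar> * indicator D x)" if "D \<in> sets M" for D
    using intf that by (rule integrable_real_mult_indicator[rotated])
  have "(\<lambda>n. \<integral>x. \<bar>f x\<bar> * indicator (A n) x \<partial>M) \<longlonglongrightarrow> (\<integral>x. \<bar>f x\<bar> \<partial>M)"
  proof (rule integral_dominated_convergence[where w = "\<lambda>x. \<bar>f x\<bar>"])
    show "AE x in M. (\<lambda>n. \<bar>f x\<bar> * indicator (A n) x) \<longlonglongrightarrow> \<bar>f x\<bar>"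
    proof (rule AE_I2)
      fix x
      show "(\<lambda>n. \<bar>f x\<bar> * indicator (A n) x) \<longlonglongrightarrow> \<bar>f x\<bar>"
      proof (cases "f x = 0")
        case False
        obtain N where N: "real N > max \<bar>f x\<bar> (1 / \<bar>f x\<bar>)" using reals_Archimedean2 by blast
        have "\<bar>f x\<bar> * indicator (A n) x = \<bar>f x\<bar>" if "n \<ge> N" for n
        proof -
          have n: "real (Suc n) > \<bar>f x\<bar>" "real (Suc n) > 1 / \<bar>f x\<bar>" using N that by auto
          then have "real (Suc n) * \<bar>f x\<bar> > 1" using False by (simp add: divide_less_eq)
          with n(1) have "x \<in> A n" unfolding A_def by blast
          then show ?thesis by simp
        qed
        then show ?thesis
          by (intro tendsto_eventually) (auto simp: eventually_sequentially)
      qed simp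
    qed
  next
    show "(\<lambda>x. \<bar>f x\<bar>) \<in> borel_measurable M"
      by (rule borel_measurable_integrable[OF intf])
    show "(\<lambda>x. \<bar>f x\<bar> * indicator (A n) x) \<in> borel_measurable M" for n
      by (intro borel_measurable_integrable intD borel disjI1 opn)
    show "AE x in M. norm (\<bar>f x\<bar> * indicator (A n) x) \<le> \<bar>f x\<bar>" for n
      by (rule AE_I2) (simp add: indicator_def)
  qed (rule intf)
  then have "eventually (\<lambda>n. (\<integral>x. \<bar>f x\<bar> * indicator (A n) x \<partial>M) > (\<integral>x. \<bar>f x\<bar> \<partial>M) - e / 2) sequentially"
    using e by (intro order_tendstoD) auto
  then obtain n where n: "(\<integral>x. \<bar>f x\<bar> * indicator (A n) x \<partial>M) > (\<integral>x. \<bar>f x\<bar> \<partial>M) - e / 2"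
    by (auto simp: eventually_sequentially)
  have "integrable M (indicator (A n) :: 'a \<Rightarrow> real)"
  proof (rule Bochner_Integration.integrable_bound)
    show "integrable M (\<lambda>x. real (Suc n) * \<bar>f x\<bar>)" using intf by (rule integrable_mult_right)
    show "AE x in M. norm (indicator (A n) x :: real) \<le> norm (real (Suc n) * \<bar>f x\<bar>)"
      by (rule AE_I2) (auto simp: indicator_def A_def)
  qed (use borel opn in \<open>auto intro!: borel_measurable_indicator\<close>)
  then have finA: "emeasure M (A n) < \<infinity>"
    by (simp add: integrable_indicator_iff haar_space[OF M])
  define d where "d = e / (2 * real (Suc n))"
  have d: "d > 0" using e by (simp add: d_def)
  have "\<exists>K\<in>{K. compact K \<and> K \<subseteq> A n}. emeasure M (A n) < emeasure M K + ennreal d"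
  proof (rule SUP_approx_ennreal[OF _ _ haar_inner_regular[OF M opn]])
    show "{K. compact K \<and> K \<subseteq> A n} \<noteq> {}" by blast
  qed (use d finA in auto)
  then obtain K where K: "compact K" "K \<subseteq> A n" "emeasure M (A n) < emeasure M K + ennreal d"
    by blast
  have Ks: "K \<in> sets M" using K(1) by (intro borel) (simp add: compact_imp_closed)
  have As: "A n \<in> sets M" using opn by (intro borel) simp
  have finK: "emeasure M K < \<infinity>" by (rule haar_compact_finite[OF M K(1)])
  have fm: "A n \<in> fmeasurable M" "K \<in> fmeasurable M"
    using As Ks finA finK by (auto intro: fmeasurableI)
  have diff: "measure M (A n - K) \<le> d"
  proof -
    have "ennreal (measure M (A n)) < ennreal (measure M K + d)"
      using K(3) fm d by (simp add: emeasure_eq_ennreal_measure fmeasurable_def less_top[symmetric])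
    then have "measure M (A n) \<le> measure M K + d"
      using d by (subst (asm) ennreal_less_iff) auto
    moreover have "measure M (A n - K) = measure M (A n) - measure M K"
      using fm K(2) by (simp add: measurable_measure_Diff fmeasurableD)
    ultimately show ?thesis by simp
  qed
  have DsA: "A n - K \<in> sets M" using As Ks by (rule sets.Diff)
  have "(\<integral>x. \<bar>f x\<bar> * indicator (A n - K) x \<partial>M) \<le> (\<integral>x. real (Suc n) * indicator (A n - K) x \<partial>M)"
  proof (rule integral_mono)
    have "A n - K \<in> fmeasurable M" using fm Ks by (intro fmeasurable_Diff)
    then show "integrable M (\<lambda>x. real (Suc n) * indicator (A n - K) x)"
      by (intro integrable_mult_right integrable_real_indicator) (auto simp: fmeasurable_def)
  qed (use intD[OF DsA] in \<open>auto simp: indicator_def A_def\<close>)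
  also have "\<dots> = real (Suc n) * measure M (A n - K)"
    by (simp add: haar_space[OF M])
  also have "\<dots> \<le> real (Suc n) * d" using diff by (intro mult_left_mono) auto
  also have "\<dots> = e / 2" by (simp add: d_def field_simps)
  finally have part: "(\<integral>x. \<bar>f x\<bar> * indicator (A n - K) x \<partial>M) \<le> e / 2" .
  have "(\<integral>x. \<bar>f x\<bar> * indicator (- K) x \<partial>M)
      = (\<integral>x. (\<bar>f x\<bar> - \<bar>f x\<bar> * indicator (A n) x) + \<bar>f x\<bar> * indicator (A n - K) x \<partial>M)"
    by (rule Bochner_Integration.integral_cong) (use K(2) in \<open>auto simp: indicator_def\<close>)
  also have "\<dots> = ((\<integral>x. \<bar>f x\<bar> \<partial>M) - (\<integral>x. \<bar>f x\<bar> * indicator (A n) x \<partial>M))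
      + (\<integral>x. \<bar>f x\<bar> * indicator (A n - K) x \<partial>M)"
    using intf intD[OF As] intD[OF DsA] by simp
  also have "\<dots> \<le> e" using n part by simp
  finally show thesis using K(1) that by blast
qed

lemma fun_supp_mult_subset:
  assumes "\<And>x. k x \<ge> 0"
  shows "fun_supp (pos_part (\<lambda>x. f x * k x)) \<subseteq> fun_supp (pos_part f)"
    and "fun_supp (neg_part (\<lambda>x. f x * k x)) \<subseteq> fun_supp (neg_part f)"
proof -
  have "pos_part f x \<noteq> 0" if "pos_part (\<lambda>x. f x * k x) x \<noteq> 0" for x
    using that assms[of x] mult_nonpos_nonneg[of "f x" "k x"] by (auto simp: pos_part_def max_def split: if_splits)
  then show "fun_supp (pos_part (\<lambda>x. f x * k x)) \<subseteq> fun_supp (pos_part f)"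
    unfolding fun_supp_def by (intro closure_mono) blast
  have "neg_part f x \<noteq> 0" if "neg_part (\<lambda>x. f x * k x) x \<noteq> 0" for x
    using that assms[of x] mult_nonneg_nonneg[of "f x" "k x"] by (auto simp: neg_part_def max_def split: if_splits)
  then show "fun_supp (neg_part (\<lambda>x. f x * k x)) \<subseteq> fun_supp (neg_part f)"
    unfolding fun_supp_def by (intro closure_mono) blast
qed

lemma compact_fun_supp:
  fixes g :: "'a::t2_space \<Rightarrow> real"
  assumes "compact L" "\<And>x. x \<notin> L \<Longrightarrow> g x = 0"
  shows "compact (fun_supp g)"
proof -
  have "fun_supp g \<subseteq> L"
    unfolding fun_supp_def using assms compact_imp_closed by (intro closure_minimal) auto
  then show ?thesis
    using assms(1) closed_Int_compact[of "fun_supp g" L] by (simp add: fun_supp_def Int_absorb2)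
qed

lemma class_Fc_subset_class_F1:
  assumes M: "haar_measure M"
  shows "class_Fc \<Omega>p \<Omega>m \<subseteq> class_F1 M \<Omega>p \<Omega>m"
proof
  fix f assume f: "f \<in> class_Fc \<Omega>p \<Omega>m"
  have "integrable M f"
  proof (rule haar_integrable_compact_support[OF M])
    show "compact (fun_supp (pos_part f) \<union> fun_supp (neg_part f))"
      using f by (auto simp: class_Fc_def intro: compact_Un)
    fix x assume "x \<notin> fun_supp (pos_part f) \<union> fun_supp (neg_part f)"
    then have "pos_part f x = 0" "neg_part f x = 0"
      using closure_subset[of "{x. pos_part f x \<noteq> 0}"] closure_subset[of "{x. neg_part f x \<noteq> 0}"]
      unfolding fun_supp_def by blast+
    then show "f x = 0" by (auto simp: pos_part_def neg_part_def max_def split: if_splits)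
  qed (use f in \<open>auto simp: class_Fc_def\<close>)
  with f show "f \<in> class_F1 M \<Omega>p \<Omega>m"
    by (auto simp: class_Fc_def class_F1_def)
qed

lemma class_F1_approximation:
  fixes M :: "'a::{topological_ab_group_add,t2_space} measure"
  assumes lc: "locally_compact_space (euclidean :: 'a topology)" and M: "haar_measure M"
    and f: "f \<in> class_F1 M \<Omega>p \<Omega>m" and e: "e > 0"
  obtains g where "g \<in> class_Fc \<Omega>p \<Omega>m" "(\<integral>x. f x \<partial>M) \<le> (\<integral>x. g x \<partial>M) + e"
proof -
  have cont: "continuous_on UNIV f" and int: "integrable M f" and pd: "positive_definite f"
    and f0: "f 0 = 1" and supp: "fun_supp (pos_part f) \<subseteq> \<Omega>p" "fun_supp (neg_part f) \<subseteq> \<Omega>m"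
    using f by (auto simp: class_F1_def)
  define I where "I = (\<integral>x. \<bar>f x\<bar> \<partial>M)"
  have I: "I \<ge> 0" by (simp add: I_def)
  define d where "d = e / (2 * (I + 1))"
  have d: "d > 0" using e I by (simp add: d_def)
  obtain K where K: "compact K" "(\<integral>x. \<bar>f x\<bar> * indicator (- K) x \<partial>M) \<le> e / 2"
    using integrable_continuous_tight[OF M cont int, of "e / 2"] e by auto
  obtain k L where k: "continuous_on UNIV k" and L: "compact L" "\<And>x. x \<notin> L \<Longrightarrow> k x = 0"
    and k01: "\<And>x. 0 \<le> k x" "\<And>x. k x \<le> 1" and k0: "k 0 = 1"
    and kK: "\<And>x. x \<in> K \<Longrightarrow> 1 - d \<le> k x"
    and kpd: "\<And>f. positive_definite f \<Longrightarrow> positive_definite (\<lambda>x. f x * k x)"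
    by (rule positive_definite_approximate_unit[OF lc M K(1) d]) blast
  define g where "g x = f x * k x" for x
  have gcont: "continuous_on UNIV g"
    unfolding g_def by (intro continuous_on_mult cont k)
  have g: "g \<in> class_Fc \<Omega>p \<Omega>m"
    unfolding class_Fc_def
  proof (intro CollectI conjI)
    show "compact (fun_supp (pos_part g))" "compact (fun_supp (neg_part g))"
      by (rule compact_fun_supp[OF L(1)], simp add: pos_part_def neg_part_def g_def L(2))+
    show "fun_supp (pos_part g) \<subseteq> \<Omega>p" "fun_supp (neg_part g) \<subseteq> \<Omega>m"
      using fun_supp_mult_subset[of k f] k01(1) supp unfolding g_def by blast+
    show "positive_definite g" unfolding g_def[abs_def] by (rule kpd[OF pd])
  qed (use gcont f0 k0 in \<open>auto simp: g_def\<close>)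
  have gint: "integrable M g"
    by (rule haar_integrable_compact_support[OF M gcont L(1)]) (simp add: g_def L(2))
  have intK: "integrable M (\<lambda>x. \<bar>f x\<bar> * indicator (- K) x)"
    using K(1) haar_measure_sets[OF M]
    by (intro integrable_real_mult_indicator integrable_abs int) (auto simp: compact_imp_closed)
  have "(\<integral>x. f x \<partial>M) - (\<integral>x. g x \<partial>M) = (\<integral>x. f x - g x \<partial>M)"
    by (simp add: int gint)
  also have "\<dots> \<le> (\<integral>x. \<bar>f x\<bar> * indicator (- K) x + d * \<bar>f x\<bar> \<partial>M)"
  proof (rule integral_mono)
    fix x
    have "f x - g x = f x * (1 - k x)" by (simp add: g_def algebra_simps)
    also have "\<dots> \<le> \<bar>f x\<bar> * (1 - k x)" using k01(2)[of x] by (intro mult_right_mono) auto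
    also have "\<dots> \<le> \<bar>f x\<bar> * (indicator (- K) x + d)"
      using k01(1)[of x] kK[of x] d by (intro mult_left_mono) (auto simp: indicator_def)
    finally show "f x - g x \<le> \<bar>f x\<bar> * indicator (- K) x + d * \<bar>f x\<bar>"
      by (simp add: algebra_simps)
  qed (auto intro!: int gint intK Bochner_Integration.integrable_add integrable_mult_right
        integrable_abs Bochner_Integration.integrable_diff)
  also have "\<dots> = (\<integral>x. \<bar>f x\<bar> * indicator (- K) x \<partial>M) + d * I"
    using intK int by (simp add: I_def)
  also have "\<dots> \<le> e / 2 + e / 2"
  proof (rule add_mono[OF K(2)])
    have "e * I \<le> e * (I + 1)" using e by simp
    then show "d * I \<le> e / 2" using I by (simp add: d_def field_simps)
  qed
  finally have "(\<integral>x. f x \<partial>M) \<le> (\<integral>x. g x \<partial>M) + e" by simp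
  with g show thesis by (rule that)
qed

theorem theorem2p1:
  fixes m_G :: "'a::{topological_ab_group_add,t2_space} measure"
    and \<Omega>p \<Omega>m :: "'a set"
  assumes "locally_compact_space (euclidean :: 'a topology)"
    and "haar_measure m_G"
    and "open \<Omega>p" and "zero_symmetric \<Omega>p"
    and "open \<Omega>m" and "zero_symmetric \<Omega>m"
  shows "const_C1 m_G \<Omega>p \<Omega>m = const_Cc m_G \<Omega>p \<Omega>m"
proof (cases "class_F1 m_G \<Omega>p \<Omega>m = {}")
  case True
  then show ?thesis
    using class_Fc_subset_class_F1[OF assms(2), of \<Omega>p \<Omega>m]
    by (simp add: const_C1_def const_Cc_def sup_integral_def)
next
  case False
  note approx = class_F1_approximation[OF assms(1,2)]
  have ne: "class_Fc \<Omega>p \<Omega>m \<noteq> {}"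
    using False approx[of _ \<Omega>p \<Omega>m 1] by (metis all_not_in_conv zero_less_one)
  have "(SUP f\<in>class_F1 m_G \<Omega>p \<Omega>m. ereal (\<integral>x. f x \<partial>m_G))
      = (SUP f\<in>class_Fc \<Omega>p \<Omega>m. ereal (\<integral>x. f x \<partial>m_G))" (is "?S1 = ?Sc")
  proof (rule antisym)
    show "?S1 \<le> ?Sc"
    proof (rule SUP_least)
      fix f assume f: "f \<in> class_F1 m_G \<Omega>p \<Omega>m"
      show "ereal (\<integral>x. f x \<partial>m_G) \<le> ?Sc"
      proof (rule ereal_le_epsilon2)
        fix e :: real assume "0 < e"
        then obtain g where "g \<in> class_Fc \<Omega>p \<Omega>m" "(\<integral>x. f x \<partial>m_G) \<le> (\<integral>x. g x \<partial>m_G) + e"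
          using approx[OF f] by metis
        then have "ereal (\<integral>x. f x \<partial>m_G) \<le> ereal (\<integral>x. g x \<partial>m_G) + ereal e"
          and "ereal (\<integral>x. g x \<partial>m_G) \<le> ?Sc"
          by (auto intro: SUP_upper)
        then show "ereal (\<integral>x. f x \<partial>m_G) \<le> ?Sc + ereal e"
          by (meson add_right_mono order_trans)
      qed
    qed
    show "?Sc \<le> ?S1"
      by (rule SUP_subset_mono[OF class_Fc_subset_class_F1[OF assms(2)] order_refl])
  qed
  with False ne show ?thesis
    by (simp add: const_C1_def const_Cc_def sup_integral_def)
qed

end
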